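(* For any integers $n\geq i\geq 0$, there holds $$H_{n,i}=\sum_{m=0}^{n-i}\binom{n+m+i+1}{n-i-m}C_{m}^{(2i+2)},$$ where $C_{m}^{(k)}=\frac{k}{m+k}\binom{2m+k}{m}$. Moreover, $H_{n,i}$ is the $(n,i)$-entry of the Riordan array $$\big(S(x)^2,\ xS(x)^2\big).$$
   Context: A G-Motzkin path of length $n$ is a lattice path from $(0,0)$ to $(n,0)$ in the first quadrant (never going below the $x$-axis) consisting of up steps $\mathbf{u}=(1,1)$, down steps $\mathbf{d}=(1,-1)$, horizontal steps $\mathbf{h}=(1,0)$ and vertical steps $\mathbf{v}=(0,-1)$. It is $\mathbf{uvu}$-avoiding if it contains no three consecutive steps $\mathbf{u},\mathbf{v},\mathbf{u}$. $\mathcal{G}_{n}^{\mathbf{uvu}}$ is the set of all (unweighted) $\mathbf{uvu}$-avoiding G-Motzkin paths of length $n$. A step is at level $\ell$ if the ordinate of its endpoint is $\ell$. $H_{n,i}$ is the total number of $\mathbf{h}$-steps at level $i$ in all paths $\mathbf{G}\in\mathcal{G}_{n+1}^{\mathbf{uvu}}$. $S(x)=\frac{1-x-\sqrt{1-6x+x^2}}{2x}$ is the generating function of the large Schröder numbers. For formal power series $d(x),h(x)$ with $d(0)=1$, $h(0)=0$, the Riordan array $(d(x),h(x))$ is the infinite lower triangular matrix $(d_{n,i})_{n,i\ge 0}$ with $d_{n,i}=[x^n]\,d(x)h(x)^i$, where $[x^n]$ denotes the coefficient of $x^n$.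
   Formalization: The coefficient C_m^{(k)} is taken as k/(2m+k)·binom(2m+k,m) instead of the printed k/(m+k)·binom(2m+k,m), which is a misprint: for n=1, i=0 the printed formula gives 14/3, while H_{1,0}=4. *)

theory Defs
  imports
    Complex_Main
    "HOL-Library.Product_Plus"
    "HOL-Library.Sublist"
    "HOL-Computational_Algebra.Formal_Power_Series"
begin

datatype step = Up | Down | Horiz | Vert

fun step_vec :: "step \<Rightarrow> int \<times> int" where
  "step_vec Up = (1, 1)"
| "step_vec Down = (1, -1)"
| "step_vec Horiz = (1, 0)"
| "step_vec Vert = (0, -1)"

(* The point reached from the origin; after k steps a path p is at path_end (take k p). *)
definition path_end :: "step list \<Rightarrow> int \<times> int" where
  "path_end p = sum_list (map step_vec p)"

definition G_Motzkin_path :: "nat \<Rightarrow> step list \<Rightarrow> bool" where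
  "G_Motzkin_path n p \<longleftrightarrow>
     path_end p = (int n, 0) \<and>
     (\<forall>k\<le>length p. 0 \<le> fst (path_end (take k p)) \<and> 0 \<le> snd (path_end (take k p)))"

(* The library's sublist relation means occurrence as a contiguous factor. *)
definition uvu_avoiding :: "step list \<Rightarrow> bool" where
  "uvu_avoiding p \<longleftrightarrow> \<not> sublist [Up, Vert, Up] p"

definition G_uvu :: "nat \<Rightarrow> step list set" where
  "G_uvu n = {p. G_Motzkin_path n p \<and> uvu_avoiding p}"

definition step_level :: "step list \<Rightarrow> nat \<Rightarrow> int" where
  "step_level p k = snd (path_end (take (Suc k) p))"

definition h_steps_at_level :: "step list \<Rightarrow> nat \<Rightarrow> nat" where
  "h_steps_at_level p i = card {k. k < length p \<and> p ! k = Horiz \<and> step_level p k = int i}"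

(* Paths of length n + 1, not n. *)
definition H_total :: "nat \<Rightarrow> nat \<Rightarrow> nat" where
  "H_total n i = (\<Sum>p\<in>G_uvu (n + 1). h_steps_at_level p i)"

(* The coefficient of x^m in C(x)^k, C(x) being the generating function of the Catalan
   numbers.  The source prints the denominator as m + k, a misprint for 2m + k: it would
   give the non-integer value 8/3 for m = 1, k = 2. *)
definition gen_Catalan :: "nat \<Rightarrow> nat \<Rightarrow> real" where
  "gen_Catalan k m = real k / real (2 * m + k) * real ((2 * m + k) choose m)"

(* The square root is the formal one with constant term 1; the numerator below then has
   zero constant term, so that the division is exact (see large_Schroeder_eq). *)
definition large_Schroeder_fps :: "real fps" where
  "large_Schroeder_fps =
     (1 - fps_X - fps_radical root 2 (1 - 6 * fps_X + fps_X ^ 2)) / (2 * fps_X)"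

(* The (n, i)-entry of (d(x), h(x)); meant for d(0) = 1 and h(0) = 0. *)
definition Riordan_array :: "'a::comm_ring_1 fps \<Rightarrow> 'a fps \<Rightarrow> nat \<Rightarrow> nat \<Rightarrow> 'a" where
  "Riordan_array d h n i = fps_nth (d * h ^ i) n"

(* Finiteness of G_uvu n: the sum defining H_total is a genuine finite sum. *)

lemma path_end_simps [simp]:
  "path_end [] = 0" "path_end (s # p) = step_vec s + path_end p"
  by (simp_all add: path_end_def)

lemma length_le_path_end: "int (length p) \<le> 2 * fst (path_end p) - snd (path_end p)"
proof (induction p)
  case (Cons s p)
  then show ?case by (cases s) auto
qed simp

lemma finite_G_uvu: "finite (G_uvu n)"
proof (rule finite_subset)
  have "length p \<le> 2 * n" if "G_Motzkin_path n p" for p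
    using length_le_path_end[of p] that by (simp add: G_Motzkin_path_def)
  then show "G_uvu n \<subseteq> {p. set p \<subseteq> {Up, Down, Horiz, Vert} \<and> length p \<le> 2 * n}"
    by (auto simp: G_uvu_def intro: step.exhaust)
  show "finite {p. set p \<subseteq> {Up, Down, Horiz, Vert} \<and> length p \<le> 2 * n}"
    by (rule finite_lists_length_le) simp
qed

lemma sqrt_fps_squared:
  "fps_radical root 2 (1 - 6 * fps_X + fps_X ^ 2 :: real fps) ^ 2 = 1 - 6 * fps_X + fps_X ^ 2"
  using power_radical[of "1 - 6 * fps_X + fps_X ^ 2 :: real fps" root 1]
  by (simp add: numeral_2_eq_2 fps_power_zeroth)

lemma large_Schroeder_eq:
  "2 * fps_X * large_Schroeder_fps =
     1 - fps_X - fps_radical root 2 (1 - 6 * fps_X + fps_X ^ 2)" (is "_ = ?N")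
proof -
  have "fps_nth ?N 0 = 0"
    by (simp add: fps_power_zeroth)
  then have "?N = fps_X * fps_shift 1 ?N"
    by (intro fps_ext) (simp add: fps_X_mult_nth del: fps_sub_nth)
  then have "fps_X dvd ?N"
    by (rule dvdI)
  moreover have "is_unit (2 :: real fps)"
    by (simp add: fps_is_unit_iff fps_numeral_nth)
  ultimately have "2 * fps_X dvd ?N"
    by (simp add: mult_unit_dvd_iff')
  then show ?thesis
    unfolding large_Schroeder_fps_def by (rule dvd_mult_div_cancel)
qed

(* (S(x)^2, x S(x)^2) meets the requirements on a Riordan array. *)
lemma Schroeder_Riordan:
  "fps_nth (large_Schroeder_fps ^ 2) 0 = 1" "fps_nth (fps_X * large_Schroeder_fps ^ 2) 0 = 0"
proof -
  let ?S = large_Schroeder_fps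
  let ?R = "fps_radical root 2 (1 - 6 * fps_X + fps_X ^ 2 :: real fps)"
  have R: "?R = 1 - fps_X - 2 * fps_X * ?S"
    using large_Schroeder_eq by (simp add: algebra_simps)
  have "(1 - fps_X - 2 * fps_X * ?S) ^ 2 = 1 - 6 * fps_X + fps_X ^ 2"
    using sqrt_fps_squared unfolding R .
  then have "4 * fps_X * ?S = 4 * fps_X * (1 + fps_X * ?S + fps_X * ?S ^ 2)"
    by (simp add: power2_eq_square algebra_simps)
  then have "?S = 1 + fps_X * ?S + fps_X * ?S ^ 2"
    by simp
  then have "fps_nth ?S 0 = fps_nth (1 + fps_X * ?S + fps_X * ?S ^ 2) 0"
    by simp
  also have "\<dots> = 1"
    by simp
  finally show "fps_nth (?S ^ 2) 0 = 1"
    by (simp add: fps_power_zeroth)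
qed simp

end

theory Submission
  imports Defs
begin

text \<open>
  Write $S$ for the large Schroeder series. A path with a marked \<open>h\<close>-step at level \<open>i\<close> is
  \<open>P h Q\<close>, where \<open>P\<close> climbs from level 0 to level \<open>i\<close> and \<open>Q\<close> goes back from level \<open>i\<close> to 0.
  No occurrence of \<open>uvu\<close> can use the marked step, so \<open>P\<close> and \<open>Q\<close> avoid \<open>uvu\<close> independently of
  each other (\<open>H_total_eq_convolution\<close>). With $A_i$ and $B_i$ the generating functions by width of
  the possible \<open>P\<close> and \<open>Q\<close>, the number $H_{n,i}$ is therefore the coefficient of $x^n$ in
  $A_i B_i$; the shift from $n + 1$ to $n$ pays for the marked step.

  These series are
  $$A_i = \Bigl(\frac{x S}{1 + x}\Bigr)^i S, \qquad B_i = ((1 + x) S)^i S,$$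
  so that the factors $1 + x$ cancel and $A_i B_i = x^i S^{2i+2} = S^2 (x S^2)^i$, which is the
  generating function of column \<open>i\<close> of the Riordan array. The values can be guessed by cutting at
  the passages between consecutive levels: \<open>Q\<close> has one first passage, by \<open>d\<close> or \<open>v\<close>, from each
  level to the next lower one, whence the factors $1 + x$; \<open>P\<close> has one last passage, by \<open>u\<close>,
  from each level to the next higher one, and the part before it must not end in \<open>uv\<close>, whence the
  factors $x / (1 + x)$.

  For the proof it is simpler to remove a single step than to cut at passages. Removing the first
  step of \<open>Q\<close> gives a linear recurrence in \<open>i\<close> for the $B_i$. It has only one solution in power
  series, and the values above solve it because $S = 1 + x S + x S^2$ (\<open>gf_descents_eq\<close>).
  Removing the last step of \<open>P\<close> gives a linear recurrence for the $A_i$, which determines all of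
  them from $A_0$; and $A_0 = B_0$ because both series count the walks from level 0 to itself
  (\<open>gf_ascents_eq\<close>).

  The explicit sum is the coefficient of $x^N$ in $S^k$ for $N = n - i$ and $k = 2i + 2$. It reflects
  the substitution $S = (1 - x)^{-1} C(x / (1 - x)^2)$ into the Catalan series $C$. At the
  level of coefficients, the sum satisfies the recurrence in \<open>k\<close> and \<open>N\<close> that
  $S^{k+1} = S^k + x S^{k+1} + x S^{k+2}$ gives for the coefficients of powers of $S$
  (\<open>large_Schroeder_fps_power_nth\<close>).
\<close>

section \<open>Coefficients of powers of the large Schroeder series\<close>

lemma gen_Catalan_0: "k > 0 \<Longrightarrow> gen_Catalan k 0 = 1"
  by (simp add: gen_Catalan_def)

text \<open>
  This ballot form as a difference of two binomial coefficients reduces identities between the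
  generalised Catalan numbers to Pascal's rule.
\<close>

lemma gen_Catalan_Suc:
  "gen_Catalan k (Suc m) =
     real ((2 * m + k + 1) choose Suc m) - real ((2 * m + k + 1) choose m)"
proof -
  define N where "N = 2 * m + k + 1"
  have "Suc m * (Suc N choose Suc m) = Suc N * (N choose m)"
    by (rule Suc_times_binomial)
  then have 1: "real (Suc m) * real (Suc N choose Suc m) = real (Suc N) * real (N choose m)"
    by (metis of_nat_mult)
  have 2: "real (Suc N choose Suc m) = real (N choose m) + real (N choose Suc m)"
    by simp
  have "real (Suc N) * (real (N choose Suc m) - real (N choose m)) =
      real (Suc N) * real (Suc N choose Suc m) - 2 * (real (Suc N) * real (N choose m))"
    unfolding 2 by (simp add: algebra_simps)
  also have "\<dots> = real k * real (Suc N choose Suc m)"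
    unfolding 1[symmetric] by (simp add: N_def algebra_simps)
  finally have "real (N choose Suc m) - real (N choose m) =
      real k * real (Suc N choose Suc m) / real (Suc N)"
    by (simp add: field_simps del: binomial_Suc_Suc of_nat_Suc)
  then show ?thesis
    by (simp add: gen_Catalan_def N_def del: binomial_Suc_Suc)
qed

text \<open>
  The coefficients of $C^{k+1} = C^k + x C^{k+2}$, which is the equation $C = 1 + x C^2$
  multiplied by $C^k$.
\<close>

lemma gen_Catalan_rec:
  "gen_Catalan (Suc k) (Suc m) = gen_Catalan k (Suc m) + gen_Catalan (k + 2) m"
proof (cases m)
  case 0
  then show ?thesis
    by (simp add: gen_Catalan_Suc gen_Catalan_0)
next
  case (Suc l)
  then show ?thesis
    by (simp add: gen_Catalan_Suc algebra_simps)
qed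

text \<open>
  The coefficient of $x^N$ in
  $\sum_m C_m^{(k)} x^m (1 - x)^{-(2m + k)} = \bigl((1 - x)^{-1} C(x / (1 - x)^2)\bigr)^k$, provided
  that $k$ and $N$ are not both 0: in that case \<open>gen_Catalan 0 0\<close> is 0 by division by zero, while
  the coefficient is 1.
\<close>

definition Schroeder_power_coeff :: "nat \<Rightarrow> nat \<Rightarrow> real" where
  "Schroeder_power_coeff k N =
     (\<Sum>m = 0..N. real ((N + m + k - 1) choose (N - m)) * gen_Catalan k m)"

text \<open>
  Pascal's rule splits the binomial coefficient in each summand in two. The parts with lower index
  $N - m$ make up the sum for $(k + 1, N)$; in those with lower index $N + 1 - m$ the Catalan recurrence separates the sum for
  $(k, N + 1)$ from the one for $(k + 2, N)$, the latter with its index shifted by one.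
\<close>

lemma Schroeder_power_coeff_rec:
  "Schroeder_power_coeff (Suc k) (Suc N) =
     Schroeder_power_coeff k (Suc N) + Schroeder_power_coeff (Suc k) N
       + Schroeder_power_coeff (k + 2) N"
proof -
  let ?b = "\<lambda>m. real ((N + m + k) choose (Suc N - m))"
  have pascal: "real ((Suc N + m + k) choose (Suc N - m)) =
      ?b m + (if m \<le> N then real ((N + m + k) choose (N - m)) else 0)"
    if "m \<le> Suc N" for m
    using that by (cases "m \<le> N") (auto simp: Suc_diff_le not_le le_Suc_eq)
  have "Schroeder_power_coeff (Suc k) (Suc N) =
      (\<Sum>m = 0..Suc N. ?b m * gen_Catalan (Suc k) m)
      + (\<Sum>m = 0..Suc N. (if m \<le> N then real ((N + m + k) choose (N - m)) else 0)
           * gen_Catalan (Suc k) m)"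
    unfolding Schroeder_power_coeff_def sum.distrib[symmetric]
    by (intro sum.cong refl) (use pascal in \<open>auto simp: algebra_simps\<close>)
  also have "(\<Sum>m = 0..Suc N. (if m \<le> N then real ((N + m + k) choose (N - m)) else 0)
           * gen_Catalan (Suc k) m) = Schroeder_power_coeff (Suc k) N"
    by (simp add: Schroeder_power_coeff_def)
  also have "(\<Sum>m = 0..Suc N. ?b m * gen_Catalan (Suc k) m) =
      ?b 0 * gen_Catalan (Suc k) 0 + (\<Sum>m = 0..N. ?b (Suc m) * gen_Catalan (Suc k) (Suc m))"
    by (simp only: sum.atLeast0_atMost_Suc_shift o_def)
  \<comment> \<open>For \<open>k = 0\<close> the Catalan factors differ, but then the binomial coefficient vanishes.\<close>
  also have "?b 0 * gen_Catalan (Suc k) 0 = ?b 0 * gen_Catalan k 0"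
    by (cases "k = 0") (simp_all add: gen_Catalan_0)
  also have "(\<Sum>m = 0..N. ?b (Suc m) * gen_Catalan (Suc k) (Suc m)) =
      (\<Sum>m = 0..N. ?b (Suc m) * gen_Catalan k (Suc m))
      + (\<Sum>m = 0..N. ?b (Suc m) * gen_Catalan (k + 2) m)"
    by (simp add: gen_Catalan_rec sum.distrib algebra_simps)
  also have "(\<Sum>m = 0..N. ?b (Suc m) * gen_Catalan (k + 2) m) = Schroeder_power_coeff (k + 2) N"
    by (simp add: Schroeder_power_coeff_def)
  also have "?b 0 * gen_Catalan k 0 + ((\<Sum>m = 0..N. ?b (Suc m) * gen_Catalan k (Suc m))
      + Schroeder_power_coeff (k + 2) N) =
      (\<Sum>m = 0..Suc N. ?b m * gen_Catalan k m) + Schroeder_power_coeff (k + 2) N"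
    by (simp only: sum.atLeast0_atMost_Suc_shift o_def add.assoc)
  also have "(\<Sum>m = 0..Suc N. ?b m * gen_Catalan k m) = Schroeder_power_coeff k (Suc N)"
    by (simp add: Schroeder_power_coeff_def)
  finally show ?thesis
    by simp
qed

lemma large_Schroeder_fps_eq:
  "large_Schroeder_fps = 1 + fps_X * large_Schroeder_fps + fps_X * large_Schroeder_fps ^ 2"
proof -
  let ?S = large_Schroeder_fps
  have "fps_radical root 2 (1 - 6 * fps_X + fps_X ^ 2) = 1 - fps_X - 2 * fps_X * ?S"
    using large_Schroeder_eq by (simp add: algebra_simps)
  then have "(1 - fps_X - 2 * fps_X * ?S) ^ 2 = 1 - 6 * fps_X + fps_X ^ 2"
    using sqrt_fps_squared by simp
  then have "4 * fps_X * ?S = 4 * fps_X * (1 + fps_X * ?S + fps_X * ?S ^ 2)"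
    by (simp add: power2_eq_square algebra_simps)
  then show ?thesis
    by simp
qed

lemma large_Schroeder_fps_power_nth:
  "k + N > 0 \<Longrightarrow> fps_nth (large_Schroeder_fps ^ k) N = Schroeder_power_coeff k N"
proof (induction N arbitrary: k)
  case 0
  have "fps_nth large_Schroeder_fps 0 = 1"
    by (subst large_Schroeder_fps_eq) simp
  then show ?case
    using 0 by (simp add: Schroeder_power_coeff_def gen_Catalan_0 fps_power_zeroth)
next
  case N_IH: (Suc N)
  show ?case
  proof (induction k)
    case 0
    have "Schroeder_power_coeff 0 (Suc N) = 0"
      by (simp add: Schroeder_power_coeff_def gen_Catalan_def)
    then show ?case
      by simp
  next
    case (Suc k)
    let ?S = large_Schroeder_fps
    have "?S ^ Suc k = ?S ^ k * (1 + fps_X * ?S + fps_X * ?S ^ 2)"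
      using large_Schroeder_fps_eq by simp
    also have "\<dots> = ?S ^ k + fps_X * ?S ^ Suc k + fps_X * ?S ^ (k + 2)"
      by (simp add: algebra_simps power2_eq_square)
    finally have "fps_nth (?S ^ Suc k) (Suc N) =
        fps_nth (?S ^ k + fps_X * ?S ^ Suc k + fps_X * ?S ^ (k + 2)) (Suc N)"
      by (rule arg_cong)
    also have "\<dots> = fps_nth (?S ^ k) (Suc N) + fps_nth (?S ^ Suc k) N + fps_nth (?S ^ (k + 2)) N"
      by (simp only: fps_add_nth fps_X_mult_nth) simp
    also have "\<dots> = Schroeder_power_coeff (Suc k) (Suc N)"
      using Suc.IH N_IH.IH[of "Suc k"] N_IH.IH[of "k + 2"]
      by (simp add: Schroeder_power_coeff_rec del: power_Suc)
    finally show ?case .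
  qed
qed

section \<open>Walks and their generating functions by width\<close>

text \<open>
  Walks between arbitrary levels, with recursion on the first step: unlike the condition on all
  prefixes of a path from the origin, this passes to tails.
\<close>

fun walk :: "nat \<Rightarrow> nat \<Rightarrow> step list \<Rightarrow> bool" where
  "walk a b [] \<longleftrightarrow> a = b"
| "walk a b (Up # p) \<longleftrightarrow> walk (Suc a) b p"
| "walk a b (Horiz # p) \<longleftrightarrow> walk a b p"
| "walk a b (Down # p) \<longleftrightarrow> (\<exists>c. a = Suc c \<and> walk c b p)"
| "walk a b (Vert # p) \<longleftrightarrow> (\<exists>c. a = Suc c \<and> walk c b p)"

definition width :: "step list \<Rightarrow> nat" where
  "width p = length (filter (\<lambda>s. s \<noteq> Vert) p)"

lemma width_simps [simp]:
  "width [] = 0" "width (Up # p) = Suc (width p)" "width (Down # p) = Suc (width p)"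
  "width (Horiz # p) = Suc (width p)" "width (Vert # p) = width p"
  "width (p @ q) = width p + width q"
  by (simp_all add: width_def)

lemma walk_append: "walk a b (p @ q) \<longleftrightarrow> (\<exists>c. walk a c p \<and> walk c b q)"
  by (induction a b p rule: walk.induct) auto

lemma walk_path_end: "walk a b p \<Longrightarrow> path_end p = (int (width p), int b - int a)"
  by (induction a b p rule: walk.induct) (auto simp: zero_prod_def)

text \<open>
  The abscissa never decreases along a path, so the condition to stay in the first quadrant only
  concerns the ordinate. This lemma expresses that part of it by the recursion.
\<close>

lemma walk_iff_path_end:
  "walk a b p \<longleftrightarrow> int a + snd (path_end p) = int b
     \<and> (\<forall>k\<le>length p. 0 \<le> int a + snd (path_end (take k p)))"
proof (induction p arbitrary: a)
  case (Cons s p)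
  have split: "(\<forall>k\<le>length (s # p). 0 \<le> int a + snd (path_end (take k (s # p)))) \<longleftrightarrow>
    (\<forall>k\<le>length p. 0 \<le> int a + snd (step_vec s) + snd (path_end (take k p)))"
    by (simp only: less_Suc_eq_le[symmetric] All_less_Suc2 list.size add_Suc_right add_0_right)
      (simp add: add.assoc)
  show ?case
  proof (cases s)
    case Up
    then show ?thesis
      unfolding split by (auto simp: Cons algebra_simps)
  next
    case Horiz
    then show ?thesis
      unfolding split by (auto simp: Cons)
  next
    case Down
    show ?thesis
      unfolding split using Down
      by (cases a) (auto simp: Cons algebra_simps intro!: exI[of _ 0])
  next
    case Vert
    show ?thesis
      unfolding split using Vert
      by (cases a) (auto simp: Cons algebra_simps intro!: exI[of _ 0])
  qed
qed auto

lemma fst_path_end: "fst (path_end p) = int (width p)"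
proof (induction p)
  case (Cons s p)
  then show ?case by (cases s) auto
qed simp

lemma G_Motzkin_path_iff_walk: "G_Motzkin_path n p \<longleftrightarrow> walk 0 0 p \<and> width p = n"
  by (auto simp: G_Motzkin_path_def walk_iff_path_end fst_path_end prod_eq_iff)

definition width_gf :: "step list set \<Rightarrow> real fps" where
  "width_gf X = Abs_fps (\<lambda>n. real (card {p \<in> X. width p = n}))"

text \<open>
  Vertical steps have width 0, but each of them must be paid for by an up step or by the height
  of the start, so the width still bounds the length.
\<close>

lemma finite_walks_of_width:
  assumes "X \<subseteq> {p. walk a b p}"
  shows "finite {p \<in> X. width p = n}"
proof (rule finite_subset)
  have "length p \<le> 2 * n + a" if "walk a b p" "width p = n" for p
    using length_le_path_end[of p] walk_path_end[OF that(1)] that(2) by simp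
  with assms show "{p \<in> X. width p = n}
      \<subseteq> {p. set p \<subseteq> {Up, Down, Horiz, Vert} \<and> length p \<le> 2 * n + a}"
    by (auto intro: step.exhaust)
  show "finite {p. set p \<subseteq> {Up, Down, Horiz, Vert} \<and> length p \<le> 2 * n + a}"
    by (rule finite_lists_length_le) simp
qed

lemma width_gf_Un:
  assumes "X \<union> Y \<subseteq> {p. walk a b p}" "X \<inter> Y = {}"
  shows "width_gf (X \<union> Y) = width_gf X + width_gf Y"
proof (rule fps_ext)
  fix n
  have "{p \<in> X \<union> Y. width p = n} = {p \<in> X. width p = n} \<union> {p \<in> Y. width p = n}"
    by blast
  moreover have "finite {p \<in> X. width p = n}" "finite {p \<in> Y. width p = n}"
    using assms(1) by (auto intro!: finite_walks_of_width)
  ultimately show "fps_nth (width_gf (X \<union> Y)) n = fps_nth (width_gf X + width_gf Y) n"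
    using assms(2) by (subst (asm) disjoint_iff) (simp add: width_gf_def card_Un_disjoint disjoint_iff)
qed

lemma width_gf_image:
  assumes "inj f" "\<And>p. width (f p) = width p + k"
  shows "width_gf (f ` X) = fps_X ^ k * width_gf X"
proof (rule fps_ext)
  fix n
  have "{q \<in> f ` X. width q = n} = f ` {p \<in> X. width p + k = n}"
    using assms(2) by auto
  then have "card {q \<in> f ` X. width q = n} = card {p \<in> X. width p + k = n}"
    using assms(1) by (simp add: card_image inj_on_subset)
  also have "{p \<in> X. width p + k = n} = (if n < k then {} else {p \<in> X. width p = n - k})"
    by auto
  finally show "fps_nth (width_gf (f ` X)) n = fps_nth (fps_X ^ k * width_gf X) n"
    by (simp add: width_gf_def fps_X_power_mult_nth)
qed

lemma width_gf_Cons: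
  "width_gf ((#) s ` X) = (if s = Vert then width_gf X else fps_X * width_gf X)"
  using width_gf_image[of "(#) s" "if s = Vert then 0 else 1" X]
  by (cases s) (auto simp: inj_def)

lemma width_gf_snoc:
  "width_gf ((\<lambda>p. p @ [s]) ` X) = (if s = Vert then width_gf X else fps_X * width_gf X)"
  using width_gf_image[of "\<lambda>p. p @ [s]" "if s = Vert then 0 else 1" X]
  by (cases s) (auto simp: inj_def)

lemma width_gf_Nil: "width_gf {[]} = 1"
proof (rule fps_ext)
  fix n
  have "{p. p = [] \<and> width p = n} = (if n = 0 then {[]} else {})"
    by auto
  then show "fps_nth (width_gf {[]}) n = fps_nth 1 n"
    by (simp add: width_gf_def)
qed

lemma uvu_avoiding_Cons:
  "uvu_avoiding (s # p) \<longleftrightarrow> uvu_avoiding p \<and> \<not> (s = Up \<and> prefix [Vert, Up] p)"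
  by (auto simp: uvu_avoiding_def sublist_Cons_right)

lemma uvu_avoiding_Nil: "uvu_avoiding []"
  by (simp add: uvu_avoiding_def)

lemma uvu_avoiding_snoc:
  "uvu_avoiding (p @ [s]) \<longleftrightarrow> uvu_avoiding p \<and> \<not> (s = Up \<and> suffix [Up, Vert] p)"
proof -
  have "suffix [Up, Vert, Up] (p @ [s]) \<longleftrightarrow> s = Up \<and> suffix [Up, Vert] p"
    using snoc_suffix_snoc[of "[Up, Vert]" Up p s] by auto
  then show ?thesis
    by (auto simp: uvu_avoiding_def sublist_snoc)
qed

text \<open>
  An occurrence of \<open>uvu\<close> across the cut would have to contain the \<open>h\<close>-step.
\<close>

lemma uvu_avoiding_around_Horiz:
  "uvu_avoiding (p @ Horiz # q) \<longleftrightarrow> uvu_avoiding p \<and> uvu_avoiding q"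
proof -
  have "xs2 = []" if "[Up, Vert, Up] = xs1 @ xs2" "prefix xs2 (Horiz # q)" for xs1 xs2
    using that by (cases xs2) (auto simp: append_eq_Cons_conv Cons_eq_append_conv)
  then have "\<not> (\<exists>xs1 xs2. [Up, Vert, Up] = xs1 @ xs2 \<and> suffix xs1 p \<and> prefix xs2 (Horiz # q))
      \<or> sublist [Up, Vert, Up] p"
    by (metis append_Nil2 suffix_imp_sublist)
  then show ?thesis
    by (auto simp: uvu_avoiding_def sublist_append sublist_Cons_right)
qed

section \<open>Removing the first step of a descent or the last step of an ascent\<close>

lemma step_list_set_eqI_Cons:
  assumes "[] \<in> A \<longleftrightarrow> [] \<in> B" "\<And>s p. s # p \<in> A \<longleftrightarrow> s # p \<in> B"
  shows "A = B"
proof (rule set_eqI)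
  show "p \<in> A \<longleftrightarrow> p \<in> B" for p
    using assms by (cases p) auto
qed

lemma step_list_set_eqI_snoc:
  assumes "[] \<in> A \<longleftrightarrow> [] \<in> B" "\<And>p s. p @ [s] \<in> A \<longleftrightarrow> p @ [s] \<in> B"
  shows "A = B"
proof (rule set_eqI)
  show "p \<in> A \<longleftrightarrow> p \<in> B" for p
    using assms by (cases p rule: rev_cases) auto
qed

definition ascents :: "nat \<Rightarrow> step list set" where
  "ascents i = {p. walk 0 i p \<and> uvu_avoiding p}"

text \<open>
  The ascents that an up step may follow.
\<close>

definition ascents_no_uv :: "nat \<Rightarrow> step list set" where
  "ascents_no_uv i = {p \<in> ascents i. \<not> suffix [Up, Vert] p}"

definition descents :: "nat \<Rightarrow> step list set" where
  "descents i = {p. walk i 0 p \<and> uvu_avoiding p}"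

text \<open>
  The descents that may follow \<open>uv\<close>.
\<close>

definition descents_no_u :: "nat \<Rightarrow> step list set" where
  "descents_no_u i = {p \<in> descents i. \<not> prefix [Up] p}"

text \<open>
  The descents that may follow \<open>u\<close>.
\<close>

definition descents_no_vu :: "nat \<Rightarrow> step list set" where
  "descents_no_vu i = {p \<in> descents i. \<not> prefix [Vert, Up] p}"

lemma ascents_0_eq_descents_0: "ascents 0 = descents 0"
  by (simp add: ascents_def descents_def)

lemma uvu_avoiding_simps:
  "uvu_avoiding []"
  "uvu_avoiding (Up # p) \<longleftrightarrow> uvu_avoiding p \<and> \<not> prefix [Vert, Up] p"
  "uvu_avoiding (Down # p) \<longleftrightarrow> uvu_avoiding p"
  "uvu_avoiding (Horiz # p) \<longleftrightarrow> uvu_avoiding p"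
  "uvu_avoiding (Vert # p) \<longleftrightarrow> uvu_avoiding p"
  by (auto simp: uvu_avoiding_Cons uvu_avoiding_Nil)

lemma gf_descents:
  "width_gf (descents i) =
     width_gf (descents_no_u i) + fps_X * width_gf (descents_no_vu (Suc i))"
proof -
  have eq: "descents i = descents_no_u i \<union> (#) Up ` descents_no_vu (Suc i)"
  proof (rule step_list_set_eqI_Cons)
    show "s # p \<in> descents i \<longleftrightarrow>
        s # p \<in> descents_no_u i \<union> (#) Up ` descents_no_vu (Suc i)" for s p
      by (cases s)
        (auto simp: descents_def descents_no_u_def descents_no_vu_def uvu_avoiding_simps)
  qed (auto simp: descents_def descents_no_u_def)
  have "width_gf (descents_no_u i \<union> (#) Up ` descents_no_vu (Suc i)) =
      width_gf (descents_no_u i) + width_gf ((#) Up ` descents_no_vu (Suc i))"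
    by (rule width_gf_Un[of _ _ i 0])
      (auto simp: descents_def descents_no_u_def descents_no_vu_def)
  then show ?thesis
    by (simp add: eq[symmetric] width_gf_Cons)
qed

text \<open>
  Removing the two initial steps of a descent that starts with \<open>vu\<close> leaves one at the same
  level, which may follow \<open>u\<close> and hence does not start with \<open>vu\<close> again.
\<close>

lemma gf_descents_Suc_no_vu:
  "width_gf (descents (Suc i)) = (1 + fps_X) * width_gf (descents_no_vu (Suc i))"
proof -
  let ?f = "\<lambda>p. Vert # Up # p"
  have "p \<in> descents (Suc i) \<longleftrightarrow> p \<in> descents_no_vu (Suc i) \<union> ?f ` descents_no_vu (Suc i)" for p
    by (auto simp: descents_def descents_no_vu_def uvu_avoiding_simps prefix_def)
  then have eq: "descents (Suc i) = descents_no_vu (Suc i) \<union> ?f ` descents_no_vu (Suc i)"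
    by blast
  have "width_gf (descents_no_vu (Suc i) \<union> ?f ` descents_no_vu (Suc i)) =
      width_gf (descents_no_vu (Suc i)) + width_gf (?f ` descents_no_vu (Suc i))"
    by (rule width_gf_Un[of _ _ "Suc i" 0]) (auto simp: descents_def descents_no_vu_def)
  also have "width_gf (?f ` descents_no_vu (Suc i)) = fps_X * width_gf (descents_no_vu (Suc i))"
    using width_gf_image[of ?f 1] by (simp add: inj_def)
  finally show ?thesis
    by (simp add: eq[symmetric] algebra_simps)
qed

lemma gf_descents_0_no_u:
  "width_gf (descents_no_u 0) = 1 + fps_X * width_gf (descents 0)"
proof -
  have eq: "descents_no_u 0 = {[]} \<union> (#) Horiz ` descents 0"
  proof (rule step_list_set_eqI_Cons)
    show "s # p \<in> descents_no_u 0 \<longleftrightarrow> s # p \<in> {[]} \<union> (#) Horiz ` descents 0" for s p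
      by (cases s) (auto simp: descents_def descents_no_u_def uvu_avoiding_simps)
  qed (auto simp: descents_def descents_no_u_def uvu_avoiding_simps)
  have "width_gf ({[]} \<union> (#) Horiz ` descents 0) =
      width_gf {[]} + width_gf ((#) Horiz ` descents 0)"
    by (rule width_gf_Un[of _ _ 0 0]) (auto simp: descents_def)
  then show ?thesis
    by (simp add: eq width_gf_Cons width_gf_Nil)
qed

lemma gf_descents_Suc_no_u:
  "width_gf (descents_no_u (Suc i)) =
     fps_X * width_gf (descents (Suc i)) + (1 + fps_X) * width_gf (descents i)"
proof -
  have eq: "descents_no_u (Suc i) = (#) Horiz ` descents (Suc i)
      \<union> ((#) Down ` descents i \<union> (#) Vert ` descents i)" (is "_ = ?A \<union> (?B \<union> ?C)")
  proof (rule step_list_set_eqI_Cons)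
    show "s # p \<in> descents_no_u (Suc i) \<longleftrightarrow> s # p \<in> ?A \<union> (?B \<union> ?C)" for s p
      by (cases s) (auto simp: descents_def descents_no_u_def uvu_avoiding_simps)
  qed (auto simp: descents_def descents_no_u_def)
  have "width_gf (?A \<union> (?B \<union> ?C)) = width_gf ?A + width_gf (?B \<union> ?C)"
    by (rule width_gf_Un[of _ _ "Suc i" 0]) (auto simp: descents_def)
  also have "width_gf (?B \<union> ?C) = width_gf ?B + width_gf ?C"
    by (rule width_gf_Un[of _ _ "Suc i" 0]) (auto simp: descents_def)
  finally show ?thesis
    by (simp add: eq width_gf_Cons algebra_simps)
qed

text \<open>
  Dually, \<open>uv\<close> can be appended exactly to the ascents that do not already end in \<open>uv\<close>.
\<close>

lemma gf_ascents_no_uv: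
  "width_gf (ascents i) = (1 + fps_X) * width_gf (ascents_no_uv i)"
proof -
  let ?f = "\<lambda>p. p @ [Up, Vert]"
  have avoid: "uvu_avoiding (p @ [Up, Vert]) \<longleftrightarrow> uvu_avoiding p \<and> \<not> suffix [Up, Vert] p" for p
    using uvu_avoiding_snoc[of "p @ [Up]" Vert] uvu_avoiding_snoc[of p Up] by simp
  have "p \<in> ascents i" if "p \<in> ascents_no_uv i \<union> ?f ` ascents_no_uv i" for p
    using that by (auto simp: ascents_def ascents_no_uv_def avoid walk_append)
  moreover have "p \<in> ascents_no_uv i \<union> ?f ` ascents_no_uv i" if "p \<in> ascents i" for p
    using that by (auto simp: ascents_def ascents_no_uv_def avoid walk_append suffix_def)
  ultimately have eq: "ascents i = ascents_no_uv i \<union> ?f ` ascents_no_uv i"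
    by blast
  have "width_gf (ascents_no_uv i \<union> ?f ` ascents_no_uv i) =
      width_gf (ascents_no_uv i) + width_gf (?f ` ascents_no_uv i)"
    by (rule width_gf_Un[of _ _ 0 i]) (auto simp: ascents_def ascents_no_uv_def walk_append suffix_def)
  also have "width_gf (?f ` ascents_no_uv i) = fps_X * width_gf (ascents_no_uv i)"
    using width_gf_image[of ?f 1] by (simp add: inj_def)
  finally show ?thesis
    by (simp add: eq[symmetric] algebra_simps)
qed

lemma gf_ascents_0:
  "width_gf (ascents 0) = 1 + fps_X * width_gf (ascents 0) + (1 + fps_X) * width_gf (ascents 1)"
proof -
  have eq: "ascents 0 = {[]} \<union> ((\<lambda>p. p @ [Horiz]) ` ascents 0
      \<union> ((\<lambda>p. p @ [Down]) ` ascents 1 \<union> (\<lambda>p. p @ [Vert]) ` ascents 1))"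
    (is "_ = ?A \<union> (?B \<union> (?C \<union> ?D))")
  proof (rule step_list_set_eqI_snoc)
    show "p @ [s] \<in> ascents 0 \<longleftrightarrow> p @ [s] \<in> ?A \<union> (?B \<union> (?C \<union> ?D))" for p s
      by (cases s) (auto simp: ascents_def uvu_avoiding_snoc walk_append)
  qed (simp add: ascents_def uvu_avoiding_simps)
  have "width_gf (?A \<union> (?B \<union> (?C \<union> ?D))) = width_gf ?A + width_gf (?B \<union> (?C \<union> ?D))"
    by (rule width_gf_Un[of _ _ 0 0]) (auto simp: ascents_def walk_append)
  also have "width_gf (?B \<union> (?C \<union> ?D)) = width_gf ?B + width_gf (?C \<union> ?D)"
    by (rule width_gf_Un[of _ _ 0 0]) (auto simp: ascents_def walk_append)
  also have "width_gf (?C \<union> ?D) = width_gf ?C + width_gf ?D"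
    by (rule width_gf_Un[of _ _ 0 0]) (auto simp: ascents_def walk_append)
  finally show ?thesis
    unfolding eq[symmetric] by (simp add: width_gf_snoc width_gf_Nil algebra_simps)
qed

lemma gf_ascents_Suc:
  "width_gf (ascents (Suc i)) = fps_X * width_gf (ascents_no_uv i)
     + fps_X * width_gf (ascents (Suc i)) + (1 + fps_X) * width_gf (ascents (i + 2))"
proof -
  have eq: "ascents (Suc i) = (\<lambda>p. p @ [Up]) ` ascents_no_uv i
      \<union> ((\<lambda>p. p @ [Horiz]) ` ascents (Suc i)
      \<union> ((\<lambda>p. p @ [Down]) ` ascents (i + 2) \<union> (\<lambda>p. p @ [Vert]) ` ascents (i + 2)))"
    (is "_ = ?A \<union> (?B \<union> (?C \<union> ?D))")
  proof (rule step_list_set_eqI_snoc)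
    show "p @ [s] \<in> ascents (Suc i) \<longleftrightarrow> p @ [s] \<in> ?A \<union> (?B \<union> (?C \<union> ?D))" for p s
      by (cases s) (auto simp: ascents_def ascents_no_uv_def uvu_avoiding_snoc walk_append)
  qed (auto simp: ascents_def)
  have "width_gf (?A \<union> (?B \<union> (?C \<union> ?D))) = width_gf ?A + width_gf (?B \<union> (?C \<union> ?D))"
    by (rule width_gf_Un[of _ _ 0 "Suc i"]) (auto simp: ascents_def ascents_no_uv_def walk_append)
  also have "width_gf (?B \<union> (?C \<union> ?D)) = width_gf ?B + width_gf (?C \<union> ?D)"
    by (rule width_gf_Un[of _ _ 0 "Suc i"]) (auto simp: ascents_def walk_append)
  also have "width_gf (?C \<union> ?D) = width_gf ?C + width_gf ?D"
    by (rule width_gf_Un[of _ _ 0 "Suc i"]) (auto simp: ascents_def walk_append)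
  finally show ?thesis
    unfolding eq[symmetric] by (simp add: width_gf_snoc algebra_simps)
qed

section \<open>Closed forms for ascents and descents\<close>

text \<open>
  The homogeneous recurrence expresses the coefficient of $x^n$ in $d_i$ by coefficients of
  $x^m$ in $d_j$ with $2m + j < 2n + i$: an index \<open>i + 2\<close> on the right always comes with a factor
  $x$. Hence two solutions of the recurrence for descents with the same inhomogeneous part agree.
\<close>

lemma descent_recurrence_zero:
  fixes d :: "nat \<Rightarrow> real fps"
  assumes d0: "d 0 = fps_X ^ 2 * d 0 + fps_X * d 1"
    and dSuc: "\<And>i. d (Suc i) =
      fps_X ^ 2 * d (Suc i) + (1 + fps_X) ^ 2 * d i + fps_X * d (i + 2)"
  shows "d i = 0"
proof -
  have "fps_nth (d i) n = 0" for i n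
  proof (induction "2 * n + i" arbitrary: i n rule: less_induct)
    case less
    have lower: "fps_nth (fps_X ^ 2 * d i) n = 0" "fps_nth (fps_X * d (Suc i)) n = 0"
      using less[of "n - 2" i] less[of "n - 1" "Suc i"]
      by (auto simp: fps_X_power_mult_nth)
    show ?case
    proof (cases i)
      case 0
      then show ?thesis
        using lower d0 by (metis One_nat_def add.right_neutral fps_add_nth)
    next
      case (Suc j)
      have "fps_nth ((1 + fps_X) ^ 2 * d j) n =
          fps_nth (d j + fps_X * d j + fps_X * (d j + fps_X * d j)) n"
        by (simp add: power2_eq_square algebra_simps)
      also have "\<dots> = 0"
      proof -
        have "fps_nth (d j) m = 0" if "m \<le> n" for m
          by (rule less) (use that Suc in simp)
        then show ?thesis
          by simp
      qed
      finally have "fps_nth ((1 + fps_X) ^ 2 * d j) n = 0" .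
      moreover have "fps_nth (d (Suc j)) n = fps_nth (fps_X ^ 2 * d (Suc j)) n
          + fps_nth ((1 + fps_X) ^ 2 * d j) n + fps_nth (fps_X * d (j + 2)) n"
        by (subst dSuc) (simp only: fps_add_nth)
      ultimately show ?thesis
        using lower Suc by (simp only: add_2_eq_Suc' add_0)
    qed
  qed
  then show ?thesis
    by (simp add: fps_eq_iff)
qed

text \<open>
  The recurrence for all descents involves the series of those that may follow \<open>u\<close>. At positive
  levels the former is $1 + x$ times the latter, so multiplication by $1 + x$ leaves a recurrence
  for the former alone, and the difference between the true and the claimed solution satisfies
  its homogeneous version.
\<close>

lemma gf_descents_eq:
  "width_gf (descents i) = (1 + fps_X) ^ i * large_Schroeder_fps ^ Suc i"
proof -
  define S where "S = large_Schroeder_fps"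
  have S: "S = 1 + fps_X * S + fps_X * S ^ 2"
    unfolding S_def by (rule large_Schroeder_fps_eq)
  define b where "b i = width_gf (descents i)" for i
  define u where "u i = width_gf (descents_no_vu i)" for i
  define c where "c i = (1 + fps_X) ^ i * S ^ Suc i" for i
  define d where "d i = b i - c i" for i
  have bu: "b (Suc i) = (1 + fps_X) * u (Suc i)" for i
    unfolding b_def u_def by (rule gf_descents_Suc_no_vu)
  have b0: "b 0 = 1 + fps_X * b 0 + fps_X * u 1"
    unfolding b_def u_def using gf_descents[of 0] by (simp add: gf_descents_0_no_u)
  have bSuc: "b (Suc i) = fps_X * b (Suc i) + (1 + fps_X) * b i + fps_X * u (i + 2)" for i
    unfolding b_def u_def using gf_descents[of "Suc i"] by (simp add: gf_descents_Suc_no_u)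
  have "b 0 = (1 + fps_X) * (1 + fps_X * b 0 + fps_X * u 1) - fps_X * b 0"
    using b0 by (simp add: algebra_simps)
  also have "\<dots> = 1 + fps_X + fps_X ^ 2 * b 0 + fps_X * b 1"
    using bu[of 0] by (simp add: algebra_simps power2_eq_square)
  finally have b0': "b 0 = 1 + fps_X + fps_X ^ 2 * b 0 + fps_X * b 1" .
  have bSuc': "b (Suc i) = fps_X ^ 2 * b (Suc i) + (1 + fps_X) ^ 2 * b i + fps_X * b (i + 2)" for i
  proof -
    have "b (Suc i) = (1 + fps_X) * (fps_X * b (Suc i) + (1 + fps_X) * b i + fps_X * u (i + 2))
        - fps_X * b (Suc i)"
      using bSuc[of i] by (simp add: algebra_simps)
    also have "\<dots> = fps_X ^ 2 * b (Suc i) + (1 + fps_X) ^ 2 * b i + fps_X * b (i + 2)"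
      using bu[of "Suc i"] by (simp add: algebra_simps power2_eq_square)
    finally show ?thesis .
  qed
  have c0: "c 0 = 1 + fps_X + fps_X ^ 2 * c 0 + fps_X * c 1"
    unfolding c_def using S by simp algebra
  have cSuc: "c (Suc i) = fps_X ^ 2 * c (Suc i) + (1 + fps_X) ^ 2 * c i + fps_X * c (i + 2)" for i
  proof -
    have "c (Suc i) - (fps_X ^ 2 * c (Suc i) + (1 + fps_X) ^ 2 * c i + fps_X * c (i + 2)) =
        (1 + fps_X) ^ 2 * c i * (S - (1 + fps_X * S + fps_X * S ^ 2))"
      by (simp add: c_def power2_eq_square algebra_simps)
    also have "S - (1 + fps_X * S + fps_X * S ^ 2) = 0"
      using S by (simp only: right_minus_eq)
    finally show ?thesis
      by (simp only: mult_zero_right right_minus_eq)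
  qed
  have "d i = 0"
  proof (rule descent_recurrence_zero)
    show "d 0 = fps_X ^ 2 * d 0 + fps_X * d 1"
      unfolding d_def using b0' c0 by algebra
    show "d (Suc i) = fps_X ^ 2 * d (Suc i) + (1 + fps_X) ^ 2 * d i + fps_X * d (i + 2)" for i
      unfolding d_def using bSuc'[of i] cSuc[of i] by algebra
  qed
  then show ?thesis
    by (simp add: d_def b_def c_def S_def)
qed

text \<open>
  The recurrence for ascents, in contrast, can be solved forwards: it yields $(1 + x) a_{i+2}$
  from $a_{i+1}$ and $a_i$, and its initial value $a_0$ is already known from the descents.
  The statement is multiplied by $(1 + x)^i$ to avoid division.
\<close>

lemma gf_ascents_eq:
  "(1 + fps_X) ^ i * width_gf (ascents i) = fps_X ^ i * large_Schroeder_fps ^ Suc i"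
proof -
  define S where "S = large_Schroeder_fps"
  have S: "S = 1 + fps_X * S + fps_X * S ^ 2"
    unfolding S_def by (rule large_Schroeder_fps_eq)
  define a where "a i = width_gf (ascents i)" for i
  define e where "e i = width_gf (ascents_no_uv i)" for i
  have ae: "a i = (1 + fps_X) * e i" for i
    unfolding a_def e_def by (rule gf_ascents_no_uv)
  have a0: "a 0 = 1 + fps_X * a 0 + (1 + fps_X) * a 1"
    unfolding a_def by (rule gf_ascents_0)
  have aSuc: "a (Suc i) = fps_X * e i + fps_X * a (Suc i) + (1 + fps_X) * a (i + 2)" for i
    unfolding a_def e_def by (rule gf_ascents_Suc)
  have a0_eq: "a 0 = S"
    by (simp add: a_def S_def ascents_0_eq_descents_0 gf_descents_eq)
  have "(1 + fps_X) ^ i * a i = fps_X ^ i * S ^ Suc i"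
  proof (induction i rule: induct_nat_012)
    case 0
    show ?case by (simp add: a0_eq)
  next
    case 1
    have "(1 + fps_X) * a 1 = fps_X * S ^ 2"
      using a0 S unfolding a0_eq by algebra
    then show ?case
      by (simp add: power2_eq_square)
  next
    case (ge2 n)
    define q :: "real fps" where "q = (1 + fps_X) ^ n"
    have "q * ((1 + fps_X) ^ 2 * a (n + 2)) =
        q * (1 + fps_X) * a (Suc n) - fps_X * (q * (1 + fps_X) * a (Suc n)) - fps_X * (q * a n)"
      using aSuc[of n] ae[of n] by algebra
    also have "q * (1 + fps_X) * a (Suc n) = fps_X ^ Suc n * S ^ Suc (Suc n)"
      using ge2(2) by (simp add: q_def mult_ac)
    also have "q * a n = fps_X ^ n * S ^ Suc n"
      using ge2(1) by (simp add: q_def)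
    also have "fps_X ^ Suc n * S ^ Suc (Suc n) - fps_X * (fps_X ^ Suc n * S ^ Suc (Suc n))
        - fps_X * (fps_X ^ n * S ^ Suc n) = fps_X ^ Suc n * S ^ Suc n * (S - (1 + fps_X * S))"
      by (simp add: algebra_simps)
    also have "S - (1 + fps_X * S) = fps_X * S ^ 2"
      using S by algebra
    also have "fps_X ^ Suc n * S ^ Suc n * (fps_X * S ^ 2) =
        fps_X ^ Suc (Suc n) * S ^ Suc (Suc (Suc n))"
      by (simp add: power2_eq_square mult_ac)
    finally show ?case
      by (simp add: q_def power2_eq_square mult_ac)
  qed
  then show ?thesis
    by (simp add: a_def S_def)
qed

lemma gf_ascents_times_gf_descents:
  "width_gf (ascents i) * width_gf (descents i) = fps_X ^ i * large_Schroeder_fps ^ (2 * i + 2)"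
proof -
  have "width_gf (ascents i) * width_gf (descents i) =
      ((1 + fps_X) ^ i * width_gf (ascents i)) * large_Schroeder_fps ^ Suc i"
    by (simp add: gf_descents_eq mult_ac)
  also have "\<dots> = fps_X ^ i * large_Schroeder_fps ^ (Suc i + Suc i)"
    unfolding gf_ascents_eq power_add by (simp only: mult_ac)
  finally show ?thesis
    by (simp add: mult_2)
qed


section \<open>Horizontal steps at a given level\<close>

lemma card_pairs_of_width_eq_nth_mult:
  assumes "X \<subseteq> {p. walk a b p}" "Y \<subseteq> {p. walk a' b' p}"
  shows "real (card {(p, q). p \<in> X \<and> q \<in> Y \<and> width p + width q = n}) =
     fps_nth (width_gf X * width_gf Y) n"
proof -
  let ?P = "\<lambda>j. {p \<in> X. width p = j} \<times> {q \<in> Y. width q = n - j}"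
  have "{(p, q). p \<in> X \<and> q \<in> Y \<and> width p + width q = n} = (\<Union>j\<in>{0..n}. ?P j)"
    by auto
  then have "card {(p, q). p \<in> X \<and> q \<in> Y \<and> width p + width q = n} = (\<Sum>j = 0..n. card (?P j))"
    by (simp only:) (rule card_UN_disjoint; use assms in \<open>auto intro!: finite_walks_of_width\<close>)
  then show ?thesis
    by (simp add: fps_mult_nth width_gf_def card_cartesian_product)
qed

text \<open>
  The pairs of a path and the position of an \<open>h\<close>-step at level \<open>i\<close> in it correspond to the pairs of
  an ascent to level \<open>i\<close> and a descent from it, by cutting the path at that step.
\<close>

lemma H_total_eq_convolution:
  "real (H_total n i) = fps_nth (width_gf (ascents i) * width_gf (descents i)) n"
proof -
  let ?K = "\<lambda>p. {k. k < length p \<and> p ! k = Horiz \<and> step_level p k = int i}"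
  let ?R = "{(p, q). p \<in> ascents i \<and> q \<in> descents i \<and> width p + width q = n}"
  let ?T = "SIGMA p:G_uvu (n + 1). ?K p"
  let ?f = "\<lambda>(p, q). (p @ Horiz # q, length p)"
  let ?g = "\<lambda>(r, k). (take k r :: step list, drop (Suc k) r :: step list)"
  have level: "step_level (p @ Horiz # q) (length p) = snd (path_end p)" for p q
    by (simp add: step_level_def path_end_def)
  have factor: "p @ Horiz # q \<in> G_uvu (n + 1) \<and> length p \<in> ?K (p @ Horiz # q) \<longleftrightarrow> (p, q) \<in> ?R" for p q
  proof -
    have "c = i" if "walk 0 c p" "snd (path_end p) = int i" for c
      using walk_path_end[OF that(1)] that(2) by simp
    moreover have "snd (path_end p) = int i" if "walk 0 i p"
      using walk_path_end[OF that] by simp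
    ultimately show ?thesis
      by (auto simp: G_uvu_def G_Motzkin_path_iff_walk walk_append uvu_avoiding_around_Horiz
          level ascents_def descents_def)
  qed
  have "bij_betw ?f ?R ?T"
  proof (rule bij_betw_byWitness[where f' = ?g])
    show "?f ` ?R \<subseteq> ?T"
    proof (rule image_subsetI)
      fix x assume "x \<in> ?R"
      then show "?f x \<in> ?T"
        using factor[of "fst x" "snd x"] by (simp add: case_prod_beta)
    qed
    have split: "take k r @ Horiz # drop (Suc k) r = r \<and> length (take k r) = k"
      if "k < length r" "r ! k = Horiz" for r k
      using that id_take_nth_drop[of k r] by simp
    show "\<forall>y\<in>?T. ?f (?g y) = y"
      using split by (simp add: case_prod_beta mem_Sigma_iff prod_eq_iff)
    show "?g ` ?T \<subseteq> ?R"
    proof (rule image_subsetI)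
      fix y assume y: "y \<in> ?T"
      obtain r k where "y = (r, k)"
        by (cases y)
      with y show "?g y \<in> ?R"
        using split[of k r] factor[of "take k r" "drop (Suc k) r"] by simp
    qed
  qed (simp add: case_prod_beta)
  then have "card ?R = card ?T"
    by (rule bij_betw_same_card)
  also have "\<dots> = H_total n i"
    by (simp add: H_total_def h_steps_at_level_def finite_G_uvu)
  finally show ?thesis
    using card_pairs_of_width_eq_nth_mult[of "ascents i" 0 i "descents i" i 0 n]
    by (auto simp: ascents_def descents_def)
qed

theorem theorem4p5:
  fixes n i :: nat
  assumes "i \<le> n"
  shows "real (H_total n i) =
           (\<Sum>m = 0..n - i. real ((n + m + i + 1) choose (n - i - m)) * gen_Catalan (2 * i + 2) m)
         \<and> real (H_total n i) =
           Riordan_array (large_Schroeder_fps ^ 2) (fps_X * large_Schroeder_fps ^ 2) n i"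
proof
  have H: "real (H_total n i) = fps_nth (fps_X ^ i * large_Schroeder_fps ^ (2 * i + 2)) n"
    by (simp only: H_total_eq_convolution gf_ascents_times_gf_descents)
  also have "\<dots> = Schroeder_power_coeff (2 * i + 2) (n - i)"
    using assms by (simp add: fps_X_power_mult_nth large_Schroeder_fps_power_nth del: power_Suc)
  also have "\<dots> = (\<Sum>m = 0..n - i. real ((n + m + i + 1) choose (n - i - m)) * gen_Catalan (2 * i + 2) m)"
    using assms unfolding Schroeder_power_coeff_def
    by (intro sum.cong refl arg_cong2[of _ _ _ _ "(*)"] arg_cong[of _ _ real]
        arg_cong2[of _ _ _ _ "(choose)"]) auto
  finally show "real (H_total n i) =
      (\<Sum>m = 0..n - i. real ((n + m + i + 1) choose (n - i - m)) * gen_Catalan (2 * i + 2) m)" .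
  have "fps_X ^ i * large_Schroeder_fps ^ (2 * i + 2) =
      large_Schroeder_fps ^ 2 * (fps_X * large_Schroeder_fps ^ 2) ^ i"
    by (simp add: power_mult_distrib power_mult power_add mult_ac power2_eq_square)
  then show "real (H_total n i) =
      Riordan_array (large_Schroeder_fps ^ 2) (fps_X * large_Schroeder_fps ^ 2) n i"
    by (simp only: H Riordan_array_def)
qed

end
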